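(* Let $n\in\mathbb{N}\cup\{\infty\}$ and let $(G,+,0)$ be an abelian group. Let $\mathbf{c}=(c_i)_{i\in\mathbb{Z}_n}\in G^n$ be a sequence of elements of $G$ such that $c_0=0$ and the group $G$ is generated by the set $\{c_i\mid i\in\mathbb{Z}_n\}$. Define, for $(a,i),(b,j)\in G\times\mathbb{Z}_n$, $$\sigma_{(a,i)}((b,j))=(b+c_{i-j-1}-c_{-j-1},\,j+1),\qquad \tau_{(a,i)}((b,j))=(b-c_{i-j+1}+c_{-j},\,j-1).$$ Then $(G\times\mathbb{Z}_n,\sigma,\tau)$ is an indecomposable solution of multipermutation level $2$. Moreover, for any $(e,k)\in G\times\mathbb{Z}_n$, the permutation group is the (internal) semidirect product $$\mathcal{G}(G\times\mathbb{Z}_n)=\mathrm{Dis}(G\times\mathbb{Z}_n)\rtimes\langle\sigma_{(e,k)}\rangle .$$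
   Context: $\mathbb{N}$ denotes the positive integers. $\mathbb{Z}_n=\mathbb{Z}/n\mathbb{Z}$ for finite $n$, and $\mathbb{Z}_\infty=\mathbb{Z}$; indices of $c$ and second coordinates are computed in $\mathbb{Z}_n$. A solution (set-theoretic, non-degenerate, involutive solution of the Yang-Baxter equation) is a triple $(X,\sigma,\tau)$ with $X$ a non-empty set and $\sigma,\tau\colon X^2\to X$ such that, writing $\sigma_x=\sigma(x,\cdot)$ and $\tau_y=\tau(\cdot,y)$, the map $r\colon X^2\to X^2$, $r(x,y)=(\sigma_x(y),\tau_y(x))$ is a bijection satisfying $(\mathrm{id}\times r)(r\times \mathrm{id})(\mathrm{id}\times r)=(r\times \mathrm{id})(\mathrm{id}\times r)(r\times \mathrm{id})$, all $\sigma_x,\tau_y$ are bijections, and $r^2=\mathrm{id}$. The permutation group is $\mathcal{G}(X)=\langle\sigma_x\mid x\in X\rangle\le \mathrm{Sym}(X)$; the solution is indecomposable if $\mathcal{G}(X)$ acts transitively on $X$. The displacement group is $\mathrm{Dis}(X)=\langle\sigma_x\sigma_y^{-1}\mid x,y\in X\rangle$. Put $x\sim y$ iff $\tau_x=\tau_y$. The quotient $X/{\sim}$ carries an induced solution, the retraction $\mathrm{Ret}(X)$. The solution is a permutation solution (multipermutation level $1$) if $|\mathrm{Ret}(X)|=1$, and a non-permutation solution has multipermutation level $2$ if $|\mathrm{Ret}(\mathrm{Ret}(X))|=1$.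
   Formalization: Multipermutation level 2 is asserted only for nontrivial G; for G = {0} (forced when n = 1) all τ agree, so the solution is a permutation solution of level 1, as is stated instead; all other claims hold for every G. *)

theory Defs
  imports "HOL-Algebra.Group_Action" "HOL-Algebra.Elementary_Groups" "HOL-Library.Extended_Nat"
begin

text \<open>Both operations are curried with the subscript first: \<open>\<sigma> x y\<close> is $\sigma_x(y)$ and
  \<open>\<tau> y x\<close> is $\tau_y(x)$. Only their values on \<open>S\<close> are relevant.\<close>

definition ybe_map :: "('x \<Rightarrow> 'x \<Rightarrow> 'x) \<Rightarrow> ('x \<Rightarrow> 'x \<Rightarrow> 'x) \<Rightarrow> 'x \<times> 'x \<Rightarrow> 'x \<times> 'x" where
  "ybe_map \<sigma> \<tau> = (\<lambda>(x, y). (\<sigma> x y, \<tau> y x))"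

definition map12 :: "('x \<times> 'x \<Rightarrow> 'x \<times> 'x) \<Rightarrow> 'x \<times> 'x \<times> 'x \<Rightarrow> 'x \<times> 'x \<times> 'x" where
  "map12 r = (\<lambda>(x, y, z). (fst (r (x, y)), snd (r (x, y)), z))"

definition map23 :: "('x \<times> 'x \<Rightarrow> 'x \<times> 'x) \<Rightarrow> 'x \<times> 'x \<times> 'x \<Rightarrow> 'x \<times> 'x \<times> 'x" where
  "map23 r = (\<lambda>(x, y, z). (x, r (y, z)))"

definition ybe_solution :: "'x set \<Rightarrow> ('x \<Rightarrow> 'x \<Rightarrow> 'x) \<Rightarrow> ('x \<Rightarrow> 'x \<Rightarrow> 'x) \<Rightarrow> bool" where
  "ybe_solution S \<sigma> \<tau> \<longleftrightarrow>
     S \<noteq> {} \<and>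
     bij_betw (ybe_map \<sigma> \<tau>) (S \<times> S) (S \<times> S) \<and>
     (\<forall>t \<in> S \<times> S \<times> S.
        map23 (ybe_map \<sigma> \<tau>) (map12 (ybe_map \<sigma> \<tau>) (map23 (ybe_map \<sigma> \<tau>) t)) =
        map12 (ybe_map \<sigma> \<tau>) (map23 (ybe_map \<sigma> \<tau>) (map12 (ybe_map \<sigma> \<tau>) t))) \<and>
     (\<forall>x \<in> S. bij_betw (\<sigma> x) S S) \<and>
     (\<forall>y \<in> S. bij_betw (\<tau> y) S S) \<and>
     (\<forall>p \<in> S \<times> S. ybe_map \<sigma> \<tau> (ybe_map \<sigma> \<tau> p) = p)"

text \<open>Sym(S) is \<^const>\<open>BijGroup\<close>, whose elements are extensional; hence the restrictions.\<close>

definition perm_group :: "'x set \<Rightarrow> ('x \<Rightarrow> 'x \<Rightarrow> 'x) \<Rightarrow> ('x \<Rightarrow> 'x) monoid" where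
  "perm_group S \<sigma> =
     (BijGroup S)\<lparr>carrier := generate (BijGroup S) {restrict (\<sigma> x) S | x. x \<in> S}\<rparr>"

definition dis_group :: "'x set \<Rightarrow> ('x \<Rightarrow> 'x \<Rightarrow> 'x) \<Rightarrow> ('x \<Rightarrow> 'x) set" where
  "dis_group S \<sigma> =
     generate (BijGroup S)
       {restrict (\<sigma> x) S \<otimes>\<^bsub>BijGroup S\<^esub> inv\<^bsub>BijGroup S\<^esub> (restrict (\<sigma> y) S) | x y. x \<in> S \<and> y \<in> S}"

definition indecomposable :: "'x set \<Rightarrow> ('x \<Rightarrow> 'x \<Rightarrow> 'x) \<Rightarrow> bool" where
  "indecomposable S \<sigma> \<longleftrightarrow> transitive_action (perm_group S \<sigma>) S (\<lambda>g. g)"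

definition ret_rel :: "'x set \<Rightarrow> ('x \<Rightarrow> 'x \<Rightarrow> 'x) \<Rightarrow> ('x \<times> 'x) set" where
  "ret_rel S \<tau> = {(x, y). x \<in> S \<and> y \<in> S \<and> (\<forall>z \<in> S. \<tau> x z = \<tau> y z)}"

text \<open>For a solution, the class of \<open>f x y\<close> (\<open>f\<close> being \<open>\<sigma>\<close> or \<open>\<tau>\<close>) does not depend on the choice
  of representatives, so the union in \<open>ret_op\<close> is just that class.\<close>

definition ret_op ::
  "'x set \<Rightarrow> ('x \<Rightarrow> 'x \<Rightarrow> 'x) \<Rightarrow> ('x \<Rightarrow> 'x \<Rightarrow> 'x) \<Rightarrow> 'x set \<Rightarrow> 'x set \<Rightarrow> 'x set" where
  "ret_op S \<tau> f A B = (\<Union>x \<in> A. \<Union>y \<in> B. ret_rel S \<tau> `` {f x y})"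

definition Ret ::
  "'x set \<times> ('x \<Rightarrow> 'x \<Rightarrow> 'x) \<times> ('x \<Rightarrow> 'x \<Rightarrow> 'x) \<Rightarrow>
   'x set set \<times> ('x set \<Rightarrow> 'x set \<Rightarrow> 'x set) \<times> ('x set \<Rightarrow> 'x set \<Rightarrow> 'x set)" where
  "Ret = (\<lambda>(S, \<sigma>, \<tau>). (S // ret_rel S \<tau>, ret_op S \<tau> \<sigma>, ret_op S \<tau> \<tau>))"

definition permutation_solution :: "'x set \<Rightarrow> ('x \<Rightarrow> 'x \<Rightarrow> 'x) \<Rightarrow> ('x \<Rightarrow> 'x \<Rightarrow> 'x) \<Rightarrow> bool" where
  "permutation_solution S \<sigma> \<tau> \<longleftrightarrow> ybe_solution S \<sigma> \<tau> \<and> card (fst (Ret (S, \<sigma>, \<tau>))) = 1"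

definition multipermutation_level_2 :: "'x set \<Rightarrow> ('x \<Rightarrow> 'x \<Rightarrow> 'x) \<Rightarrow> ('x \<Rightarrow> 'x \<Rightarrow> 'x) \<Rightarrow> bool" where
  "multipermutation_level_2 S \<sigma> \<tau> \<longleftrightarrow>
     ybe_solution S \<sigma> \<tau> \<and> \<not> permutation_solution S \<sigma> \<tau> \<and>
     card (fst (Ret (Ret (S, \<sigma>, \<tau>)))) = 1"

definition internal_semidirect_product :: "('g, 'b) monoid_scheme \<Rightarrow> 'g set \<Rightarrow> 'g set \<Rightarrow> bool" where
  "internal_semidirect_product K N H \<longleftrightarrow>
     normal N K \<and> subgroup H K \<and> N \<inter> H = {\<one>\<^bsub>K\<^esub>} \<and> N <#>\<^bsub>K\<^esub> H = carrier K"

text \<open>$\mathbb{Z}_n$ is \<open>integer_mod_group (zmodulus n)\<close>, with carrier \<open>{0..<n}\<close> for finite \<open>n\<close> and all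
  integers for modulus \<open>0\<close>. Since \<open>x mod 0 = x\<close>, reduction by \<open>zred\<close> is correct for
  \<open>n = \<infinity>\<close> too.\<close>

definition zmodulus :: "enat \<Rightarrow> nat" where
  "zmodulus n = (case n of enat m \<Rightarrow> m | \<infinity> \<Rightarrow> 0)"

definition Zset :: "enat \<Rightarrow> int set" where
  "Zset n = carrier (integer_mod_group (zmodulus n))"

definition zred :: "enat \<Rightarrow> int \<Rightarrow> int" where
  "zred n x = x mod int (zmodulus n)"

text \<open>The abelian group is written multiplicatively, following the library.\<close>

definition sol_sigma ::
  "('a, 'b) monoid_scheme \<Rightarrow> enat \<Rightarrow> (int \<Rightarrow> 'a) \<Rightarrow> 'a \<times> int \<Rightarrow> 'a \<times> int \<Rightarrow> 'a \<times> int" where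
  "sol_sigma G n c = (\<lambda>(a, i) (b, j).
     (b \<otimes>\<^bsub>G\<^esub> c (zred n (i - j - 1)) \<otimes>\<^bsub>G\<^esub> inv\<^bsub>G\<^esub> c (zred n (- j - 1)), zred n (j + 1)))"

definition sol_tau ::
  "('a, 'b) monoid_scheme \<Rightarrow> enat \<Rightarrow> (int \<Rightarrow> 'a) \<Rightarrow> 'a \<times> int \<Rightarrow> 'a \<times> int \<Rightarrow> 'a \<times> int" where
  "sol_tau G n c = (\<lambda>(a, i) (b, j).
     (b \<otimes>\<^bsub>G\<^esub> inv\<^bsub>G\<^esub> c (zred n (i - j + 1)) \<otimes>\<^bsub>G\<^esub> c (zred n (- j)), zred n (j - 1)))"

end

theory Submission
  imports Defs "HOL-Algebra.Zassenhaus"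
begin

text \<open>Write $q_{i,j} = c_{i-j-1} - c_{-j-1}$. Then $\sigma_{(a,i)}(b,j) = (b + q_{i,j}, j+1)$ depends only
  on $i$, and $\tau_{(a,i)} = \sigma_{(a,i+1)}^{-1}$. All the axioms of a solution reduce to
  $q_{j,k} + q_{i,k+1} = q_{i-1,k} + q_{j+1,k+1}$, that is, $\sigma_i\sigma_j = \sigma_{j+1}\sigma_{i-1}$.
  The latter relation shows that conjugation by any element of $\mathcal{G}$ shifts the indices of the
  generators $\sigma_i\sigma_j^{-1}$ of Dis, whence Dis is normal. It meets $\langle\sigma_k\rangle$
  trivially: Dis preserves the second coordinate, and $\sigma_k$ preserves $b - P(j)$ for a function
  $P$ on $\mathbb{Z}_n$ with $P(j+1) - P(j) = q_{k,j}$. Transitivity holds because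
  $\sigma_{k+m}\sigma_k^{-1}$ adds $c_m$ on the fibre over $k$.\<close>

section \<open>Groups with a family satisfying the exchange relation\<close>

context group
begin

context
  fixes p :: "int \<Rightarrow> 'a"
  assumes p_closed: "p i \<in> carrier G"
    and p_mult: "p i \<otimes> p j = p (j + 1) \<otimes> p (i - 1)"
begin

text \<open>The exchange relation carries \<open>p z\<close> past \<open>p i\<close> and past
  \<open>p j\<close> with the same right factor \<open>p (z - 1)\<close>, which cancels in the
  quotient.\<close>

lemma conj_generator: "p z \<otimes> (p i \<otimes> inv p j) \<otimes> inv p z = p (i + 1) \<otimes> inv p (j + 1)"
proof -
  have *: "p z \<otimes> p i = p (i + 1) \<otimes> p (z - 1)" for i
    by (rule p_mult)
  have "p z \<otimes> (p i \<otimes> inv p j) \<otimes> inv p z = (p z \<otimes> p i) \<otimes> inv (p z \<otimes> p j)"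
    by (simp add: p_closed m_assoc inv_mult_group)
  also have "\<dots> = p (i + 1) \<otimes> inv p (j + 1)"
    unfolding * using p_closed by (simp add: m_assoc inv_mult_group inv_solve_left')
      (simp add: m_assoc[symmetric])
  finally show ?thesis .
qed

text \<open>A factor \<open>p z\<close> shifts by 1, its inverse by -1, and shifts add along
  products, so a single \<open>s\<close> serves all pairs.\<close>

lemma conj_generate:
  assumes "g \<in> generate G (range p)"
  shows "\<exists>s. \<forall>i j. g \<otimes> (p i \<otimes> inv p j) \<otimes> inv g = p (i + s) \<otimes> inv p (j + s)"
  using assms
proof induction
  case one
  show ?case by (rule exI[of _ 0]) (simp add: p_closed)
next
  case (incl h)
  then show ?case using conj_generator by blast
next
  case (inv h)
  then obtain z where h: "h = p z" by blast
  have "inv h \<otimes> (p i \<otimes> inv p j) \<otimes> inv (inv h) = p (i + - 1) \<otimes> inv p (j + - 1)" for i j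
  proof -
    \<comment> \<open>The relation for \<open>p z\<close> is read backwards: the pair
      \<open>(i, j)\<close> is the image of \<open>(i - 1, j - 1)\<close>.\<close>
    have "p i \<otimes> inv p j = p z \<otimes> (p (i - 1) \<otimes> inv p (j - 1)) \<otimes> inv p z"
      using conj_generator[of z "i - 1" "j - 1"] by simp
    then show ?thesis
      unfolding h by (simp add: p_closed m_assoc) (simp add: p_closed m_assoc[symmetric])
  qed
  then show ?case by blast
next
  case (eng g h)
  then obtain s t where
    s: "\<And>i j. g \<otimes> (p i \<otimes> inv p j) \<otimes> inv g = p (i + s) \<otimes> inv p (j + s)" and
    t: "\<And>i j. h \<otimes> (p i \<otimes> inv p j) \<otimes> inv h = p (i + t) \<otimes> inv p (j + t)"
    by blast
  have gh: "g \<in> carrier G" "h \<in> carrier G"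
    using eng generate_in_carrier[of "range p"] p_closed by blast+
  have "(g \<otimes> h) \<otimes> (p i \<otimes> inv p j) \<otimes> inv (g \<otimes> h) = p (i + (t + s)) \<otimes> inv p (j + (t + s))" for i j
  proof -
    have "(g \<otimes> h) \<otimes> (p i \<otimes> inv p j) \<otimes> inv (g \<otimes> h)
        = g \<otimes> (h \<otimes> (p i \<otimes> inv p j) \<otimes> inv h) \<otimes> inv g"
      using gh p_closed by (simp add: m_assoc inv_mult_group)
    then show ?thesis by (simp add: s t add.assoc)
  qed
  then show ?case by blast
qed

text \<open>In the symmetric group of the solution, \<open>K\<close> and \<open>D\<close> become the
  permutation and the displacement group. Trivial intersection does not follow from the exchange
  relation: in additive notation the integers \<open>p i = i\<close> satisfy it, yet there
  \<open>D\<close> is the whole group. It has to come from the action on points.\<close>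

lemma semidirect_product_generate:
  defines "K \<equiv> generate G (range p)"
    and "D \<equiv> generate G {p i \<otimes> inv p j | i j. True}"
  assumes triv: "D \<inter> generate G {p k} \<subseteq> {\<one>}"
  shows "internal_semidirect_product (G\<lparr>carrier := K\<rparr>) D (generate G {p k})"
proof -
  let ?K = "G\<lparr>carrier := K\<rparr>" and ?P = "{p i \<otimes> inv p j | i j. True}" and ?H = "generate G {p k}"
  have subK: "subgroup K G"
    unfolding K_def using p_closed by (intro generate_is_subgroup) auto
  interpret K: group ?K
    by (rule subgroup_imp_group[OF subK])
  have pK: "p i \<in> K" for i
    unfolding K_def by (simp add: generate.incl)
  have PK: "?P \<subseteq> K"
    using pK subK by (auto intro: subgroup.m_closed subgroup.m_inv_closed)
  \<comment> \<open>Generation is transferred into the subgroup \<open>K\<close>, where normality is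
    claimed.\<close>
  have D: "D = generate ?K ?P"
    unfolding D_def by (rule generate_consistent[OF PK subK, symmetric])
  have H: "?H = generate ?K {p k}"
    using pK by (intro generate_consistent[OF _ subK, symmetric]) auto
  have normD: "D \<lhd> ?K"
    unfolding D
  proof (rule K.normal_generateI)
    show "?P \<subseteq> carrier ?K" using PK by simp
    fix h g assume h: "h \<in> ?P" and "g \<in> carrier ?K"
    then have g: "g \<in> generate G (range p)" "g \<in> K" by (simp_all add: K_def)
    have "inv\<^bsub>?K\<^esub> g = inv g"
      using g(2) by (rule m_inv_consistent[OF subK])
    then show "g \<otimes>\<^bsub>?K\<^esub> h \<otimes>\<^bsub>?K\<^esub> inv\<^bsub>?K\<^esub> g \<in> ?P"
      using h conj_generate[OF g(1)] by auto
  qed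
  have subH: "subgroup ?H ?K"
    unfolding H using pK by (intro K.generate_is_subgroup) auto
  have one: "\<one> \<in> D \<inter> ?H"
    by (simp add: D_def generate.one)
  have subDH: "subgroup (D <#>\<^bsub>?K\<^esub> ?H) ?K"
    by (rule K.mult_norm_subgroup[OF normD subH])
  \<comment> \<open>Since \<open>D\<close> is normal, the product is a subgroup, so it suffices to
    factor each generator \<open>p i\<close> through \<open>p k\<close>.\<close>
  have "generate ?K (range p) \<subseteq> D <#>\<^bsub>?K\<^esub> ?H"
  proof (rule K.generate_subgroup_incl[OF _ subDH], safe)
    fix i
    have "p i = (p i \<otimes> inv p k) \<otimes> p k"
      using p_closed by (simp add: m_assoc)
    moreover have "p i \<otimes> inv p k \<in> D" "p k \<in> ?H"
      unfolding D_def by (auto intro: generate.incl)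
    ultimately show "p i \<in> D <#>\<^bsub>?K\<^esub> ?H"
      unfolding set_mult_def by fastforce
  qed
  moreover have "generate ?K (range p) = K"
    using pK generate_consistent[OF _ subK, of "range p"] by (auto simp: K_def)
  ultimately have "D <#>\<^bsub>?K\<^esub> ?H = K"
    using subgroup.subset[OF subDH] by auto
  then show ?thesis
    unfolding internal_semidirect_product_def using normD subH one triv by auto
qed

end

end

section \<open>Retractions with a single class\<close>

lemma ret_relI:
  assumes "x \<in> X" "y \<in> X" "\<And>z. z \<in> X \<Longrightarrow> g x z = g y z"
  shows "(x, y) \<in> ret_rel X g"
  using assms unfolding ret_rel_def by blast

lemma equiv_ret_rel: "equiv X (ret_rel X g)"
  by (rule equivI) (auto simp: ret_rel_def refl_on_def sym_def trans_def)

text \<open>Valid for arbitrary operations, so it applies both to the solution and to its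
  retraction, without first showing that the latter is a solution.\<close>

lemma card_Ret_eq_1_iff:
  assumes "X \<noteq> {}"
  shows "card (fst (Ret (X, f, g))) = 1 \<longleftrightarrow> (\<forall>x \<in> X. \<forall>y \<in> X. (x, y) \<in> ret_rel X g)"
proof
  assume "card (fst (Ret (X, f, g))) = 1"
  then obtain A where A: "X // ret_rel X g = {A}" by (auto simp: Ret_def card_1_singleton_iff)
  then have "ret_rel X g `` {x} = A" if "x \<in> X" for x
    using quotientI[OF that, of "ret_rel X g"] by simp
  then show "\<forall>x \<in> X. \<forall>y \<in> X. (x, y) \<in> ret_rel X g"
    using equiv_class_self[OF equiv_ret_rel, of _ X g] by blast
next
  assume *: "\<forall>x \<in> X. \<forall>y \<in> X. (x, y) \<in> ret_rel X g"
  have "ret_rel X g \<subseteq> X \<times> X"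
    by (rule equiv_type[OF equiv_ret_rel])
  with * have "ret_rel X g `` {x} = X" if "x \<in> X" for x
    using that by blast
  then have "X // ret_rel X g = {X}"
    using assms by (auto simp: quotient_def)
  then show "card (fst (Ret (X, f, g))) = 1" by (simp add: Ret_def)
qed

section \<open>The symmetric group of a set\<close>

lemma carrier_BijGroup: "carrier (BijGroup X) = Bij X"
  by (simp add: BijGroup_def)

lemma BijGroup_mult_apply:
  assumes "f \<in> Bij X" "g \<in> Bij X" "x \<in> X"
  shows "(f \<otimes>\<^bsub>BijGroup X\<^esub> g) x = f (g x)"
  using assms by (simp add: BijGroup_def compose_def)

lemma BijGroup_inv_apply:
  assumes "f \<in> Bij X" "x \<in> X"
  shows "f ((inv\<^bsub>BijGroup X\<^esub> f) x) = x" "(inv\<^bsub>BijGroup X\<^esub> f) (f x) = x"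
  using assms by (auto simp: inv_BijGroup Bij_def bij_betw_def inv_into_into f_inv_into_f)

lemma Bij_apply_mem: "f \<in> Bij X \<Longrightarrow> x \<in> X \<Longrightarrow> f x \<in> X"
  using Bij_imp_funcset by blast

lemma BijGroup_inv_closed: "f \<in> Bij X \<Longrightarrow> inv\<^bsub>BijGroup X\<^esub> f \<in> Bij X"
  using group.inv_closed[OF group_BijGroup] by (simp add: carrier_BijGroup)

text \<open>Reduces invariance under a generated group to its generators. It serves for
  \<open>I = snd\<close> on the displacement group and for the corrected first coordinate on the
  cyclic group.\<close>

lemma subgroup_BijGroup_invariant:
  "subgroup {f \<in> Bij X. \<forall>x \<in> X. I (f x) = I x} (BijGroup X)"
proof (rule group.subgroupI[OF group_BijGroup])
  interpret B: group "BijGroup X" by (rule group_BijGroup)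
  show "{f \<in> Bij X. \<forall>x \<in> X. I (f x) = I x} \<noteq> {}"
    using id_Bij by fastforce
  show "inv\<^bsub>BijGroup X\<^esub> f \<in> {f \<in> Bij X. \<forall>x \<in> X. I (f x) = I x}"
    if "f \<in> {f \<in> Bij X. \<forall>x \<in> X. I (f x) = I x}" for f
    using that by (auto simp: BijGroup_inv_closed)
      (metis BijGroup_inv_apply(1) BijGroup_inv_closed Bij_apply_mem)
  show "f \<otimes>\<^bsub>BijGroup X\<^esub> g \<in> {f \<in> Bij X. \<forall>x \<in> X. I (f x) = I x}"
    if "f \<in> {f \<in> Bij X. \<forall>x \<in> X. I (f x) = I x}" "g \<in> {f \<in> Bij X. \<forall>x \<in> X. I (f x) = I x}" for f g
    using that B.m_closed[of f g] by (auto simp: BijGroup_mult_apply Bij_apply_mem carrier_BijGroup)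
qed (auto simp: carrier_BijGroup)

section \<open>The data of the construction and its cocycle\<close>

locale cyclic_family = comm_group G for G (structure) +
  fixes n :: enat and c :: "int \<Rightarrow> 'a"
  assumes c_closed: "c \<in> Zset n \<rightarrow> carrier G"
    and c_0: "c 0 = \<one>"
begin

abbreviation M :: int where "M \<equiv> int (zmodulus n)"
abbreviation S :: "('a \<times> int) set" where "S \<equiv> carrier G \<times> Zset n"
abbreviation \<sigma> :: "'a \<times> int \<Rightarrow> 'a \<times> int \<Rightarrow> 'a \<times> int" where "\<sigma> \<equiv> sol_sigma G n c"
abbreviation \<tau> :: "'a \<times> int \<Rightarrow> 'a \<times> int \<Rightarrow> 'a \<times> int" where "\<tau> \<equiv> sol_tau G n c"

text \<open>Reduction modulo 0 fixes every integer, so this covers infinite \<open>n\<close> and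
  spares later arguments a case split.\<close>

lemma mem_Zset_iff: "x \<in> Zset n \<longleftrightarrow> x mod M = x"
proof (cases "M = 0")
  case True
  then show ?thesis by (simp add: Zset_def carrier_integer_mod_group)
next
  case False
  then have "M > 0" by simp
  then have "x mod M = x \<longleftrightarrow> 0 \<le> x \<and> x < M"
    using pos_mod_bound[of M x] pos_mod_sign[of M x] by (metis mod_pos_pos_trivial)
  then show ?thesis using False by (simp add: Zset_def carrier_integer_mod_group)
qed

lemma c_mod_closed [simp]: "c (x mod M) \<in> carrier G"
  using c_closed by (auto simp: mem_Zset_iff Pi_iff)

lemma mod_mem_Zset [simp]: "x mod M \<in> Zset n"
  by (simp add: mem_Zset_iff)

text \<open>Takes arbitrary integers and reduces inside, so that index identities are checked in the
  integers.\<close>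

definition q :: "int \<Rightarrow> int \<Rightarrow> 'a" where
  "q i j = c ((i - j - 1) mod M) \<otimes> inv c ((- j - 1) mod M)"

lemma q_closed [simp]: "q i j \<in> carrier G"
  by (simp add: q_def)

lemma q_cong: "i mod M = i' mod M \<Longrightarrow> j mod M = j' mod M \<Longrightarrow> q i j = q i' j'"
  unfolding q_def
  by (intro arg_cong2[of _ _ _ _ "(\<otimes>)"] arg_cong[of _ _ c] arg_cong[of _ _ "m_inv G"] mod_diff_cong
      mod_minus_cong refl)

lemma q_mod_simps [simp]:
  "q (i mod M) j = q i j" "q (i mod M + k) j = q (i + k) j" "q (i mod M - k) j = q (i - k) j"
  "q i (j mod M) = q i j" "q i (j mod M + k) = q i (j + k)" "q i (j mod M - k) = q i (j - k)"
  by (rule q_cong; simp add: mod_simps)+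

lemma sigma_eq [simp]: "b \<in> carrier G \<Longrightarrow> \<sigma> (a, i) (b, j) = (b \<otimes> q i j, (j + 1) mod M)"
  by (simp add: sol_sigma_def zred_def q_def m_assoc)

text \<open>The indices agree: \<open>(i + 1) - (j - 1) - 1 = i - j + 1\<close> and
  \<open>- (j - 1) - 1 = - j\<close>.\<close>

lemma tau_eq [simp]:
  "b \<in> carrier G \<Longrightarrow> \<tau> (a, i) (b, j) = (b \<otimes> inv q (i + 1) (j - 1), (j - 1) mod M)"
  by (simp add: sol_tau_def zred_def q_def m_assoc inv_mult algebra_simps)

text \<open>Both sides combine the same four values of \<open>c\<close>: positively those at
  \<open>j - k - 1\<close> and \<open>i - k - 2\<close>, negatively those at \<open>- k - 1\<close>
  and \<open>- k - 2\<close>.\<close>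

lemma q_exchange: "q j k \<otimes> q i (k + 1) = q (i - 1) k \<otimes> q (j + 1) (k + 1)"
proof -
  have "i - (k + 1) - 1 = i - 1 - k - 1" "j + 1 - (k + 1) - 1 = j - k - 1" by simp_all
  then show ?thesis by (simp add: q_def m_ac)
qed

lemma q_exchange_inv: "inv q (i - 1) k \<otimes> q j k = q (j + 1) (k + 1) \<otimes> inv q i (k + 1)"
proof -
  have "inv q (i - 1) k \<otimes> q j k
      = inv q (i - 1) k \<otimes> (q j k \<otimes> q i (k + 1)) \<otimes> inv q i (k + 1)"
    by (simp add: m_assoc)
  also have "\<dots> = q (j + 1) (k + 1) \<otimes> inv q i (k + 1)"
    unfolding q_exchange[of j k i] by (simp add: m_assoc[symmetric])
  finally show ?thesis .
qed

section \<open>The axioms of a solution\<close>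

lemma sigma_mem: "x \<in> S \<Longrightarrow> y \<in> S \<Longrightarrow> \<sigma> x y \<in> S"
  and tau_mem: "x \<in> S \<Longrightarrow> y \<in> S \<Longrightarrow> \<tau> x y \<in> S"
  by (cases x; cases y; simp)+

lemma ybe_map_mem: "p \<in> S \<times> S \<Longrightarrow> ybe_map \<sigma> \<tau> p \<in> S \<times> S"
  by (cases p) (simp add: ybe_map_def sigma_mem tau_mem)

lemma ybe_map_involutive:
  assumes "p \<in> S \<times> S"
  shows "ybe_map \<sigma> \<tau> (ybe_map \<sigma> \<tau> p) = p"
  using assms
  by (auto simp: ybe_map_def mod_simps m_assoc mem_Zset_iff)

lemma braid_relation:
  assumes "t \<in> S \<times> S \<times> S"
  shows "map23 (ybe_map \<sigma> \<tau>) (map12 (ybe_map \<sigma> \<tau>) (map23 (ybe_map \<sigma> \<tau>) t)) =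
    map12 (ybe_map \<sigma> \<tau>) (map23 (ybe_map \<sigma> \<tau>) (map12 (ybe_map \<sigma> \<tau>) t))"
proof -
  obtain a i b j e k where t: "t = ((a, i), (b, j), (e, k))" by (metis surj_pair)
  then have mem: "a \<in> carrier G" "b \<in> carrier G" "e \<in> carrier G" using assms by auto
  \<comment> \<open>The three identities compare the first, second and third output coordinates,
    which carry \<open>e\<close>, \<open>b\<close> and \<open>a\<close> respectively.\<close>
  have 1: "q j k \<otimes> q i (k + 1) = q (i - 1) k \<otimes> q (j + 1) (k + 1)"
    by (rule q_exchange)
  have 2: "inv q (k + 1) (j - 1) \<otimes> q (i - 1) (j - 1) = q i j \<otimes> inv q (2 + k) j"
    using q_exchange_inv[of "k + 2" "j - 1" "i - 1"] by (simp add: add.commute)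
  have 3: "inv q (2 + k) (i - 1) \<otimes> inv q j (i - 2) = inv q (j + 1) (i - 1) \<otimes> inv q (k + 1) (i - 2)"
    using q_exchange[of j "i - 2" "k + 2"] by (simp add: m_comm add.commute flip: inv_mult)
  show ?thesis
    using 1 2 3 mem
    by (simp add: t map23_def map12_def ybe_map_def mod_simps m_assoc)
qed

text \<open>The inverse is \<open>\<tau>\<close> at the preceding index. That index may leave
  \<open>Zset n\<close>, harmlessly, because \<open>\<tau>\<close> reduces it.\<close>

lemma sigma_bij: "x \<in> S \<Longrightarrow> bij_betw (\<sigma> x) S S"
  by (rule bij_betw_byWitness[where f' = "\<tau> (fst x, snd x - 1)"])
    (auto simp: mod_simps m_assoc mem_Zset_iff)

lemma tau_bij: "x \<in> S \<Longrightarrow> bij_betw (\<tau> x) S S"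
  by (rule bij_betw_byWitness[where f' = "\<sigma> (fst x, snd x + 1)"])
    (auto simp: mod_simps m_assoc mem_Zset_iff)

lemma Zset_0 [simp]: "0 \<in> Zset n"
  by (simp add: mem_Zset_iff)

lemma ybe_solution: "ybe_solution S \<sigma> \<tau>"
  unfolding ybe_solution_def
proof (intro conjI ballI)
  have "(\<one>, 0) \<in> S" by simp
  then show "S \<noteq> {}" by blast
  show "bij_betw (ybe_map \<sigma> \<tau>) (S \<times> S) (S \<times> S)"
  proof (rule bij_betw_byWitness[where f' = "ybe_map \<sigma> \<tau>"])
    show "\<forall>p \<in> S \<times> S. ybe_map \<sigma> \<tau> (ybe_map \<sigma> \<tau> p) = p"
      by (rule ballI) (rule ybe_map_involutive)
    then show "\<forall>p \<in> S \<times> S. ybe_map \<sigma> \<tau> (ybe_map \<sigma> \<tau> p) = p" .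
    show "ybe_map \<sigma> \<tau> ` (S \<times> S) \<subseteq> S \<times> S"
      by (rule image_subsetI) (rule ybe_map_mem)
    then show "ybe_map \<sigma> \<tau> ` (S \<times> S) \<subseteq> S \<times> S" .
  qed
qed (fact braid_relation sigma_bij tau_bij ybe_map_involutive)+

section \<open>Retraction and multipermutation level\<close>

lemma ret_rel_fst_irrelevant:
  assumes "a \<in> carrier G" "a' \<in> carrier G"
  shows "ret_rel S \<tau> `` {(a, i)} = ret_rel S \<tau> `` {(a', i)}"
  using assms by (auto simp: ret_rel_def)

text \<open>Any \<open>\<tau> x\<close> lowers the index by one, and classes forget the first
  coordinate, so on the retraction every \<open>\<tau>\<close> is the same shift.\<close>

lemma ret_op_tau_const:
  assumes "A \<in> S // ret_rel S \<tau>" "B \<in> S // ret_rel S \<tau>" "C \<in> S // ret_rel S \<tau>"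
  shows "ret_op S \<tau> \<tau> A C = ret_op S \<tau> \<tau> B C"
proof -
  \<comment> \<open>Non-emptiness lets the union over \<open>A\<close> collapse once its terms are
    seen not to depend on \<open>x\<close>.\<close>
  have sub: "A \<subseteq> S \<and> A \<noteq> {}" if "A \<in> S // ret_rel S \<tau>" for A
    using in_quotient_imp_subset[OF equiv_ret_rel that] in_quotient_imp_non_empty[OF equiv_ret_rel that]
    by simp
  have *: "ret_op S \<tau> \<tau> A C = (\<Union>y \<in> C. ret_rel S \<tau> `` {(\<one>, (snd y - 1) mod M)})"
    if "A \<in> S // ret_rel S \<tau>" for A
  proof -
    have "ret_rel S \<tau> `` {\<tau> x y} = ret_rel S \<tau> `` {(\<one>, (snd y - 1) mod M)}"
      if "x \<in> S" "y \<in> S" for x y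
      using that by (cases x; cases y; simp; intro ret_rel_fst_irrelevant; simp)
    then have "(\<Union>y \<in> C. ret_rel S \<tau> `` {\<tau> x y}) = (\<Union>y \<in> C. ret_rel S \<tau> `` {(\<one>, (snd y - 1) mod M)})"
      if "x \<in> A" for x
      using that sub[OF \<open>A \<in> _\<close>] sub[OF assms(3)] by (intro SUP_cong refl) blast
    then show ?thesis
      unfolding ret_op_def using sub[OF \<open>A \<in> _\<close>] by simp
  qed
  show ?thesis using *[OF assms(1)] *[OF assms(2)] by simp
qed

lemma S_nonempty: "S \<noteq> {}"
  using ybe_solution by (simp add: ybe_solution_def)

lemma card_Ret_Ret: "card (fst (Ret (Ret (S, \<sigma>, \<tau>)))) = 1"
proof -
  have "Ret (S, \<sigma>, \<tau>) = (S // ret_rel S \<tau>, ret_op S \<tau> \<sigma>, ret_op S \<tau> \<tau>)"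
    by (simp add: Ret_def)
  moreover have "S // ret_rel S \<tau> \<noteq> {}"
    using S_nonempty by (simp add: quotient_def)
  moreover have "(A, B) \<in> ret_rel (S // ret_rel S \<tau>) (ret_op S \<tau> \<tau>)"
    if "A \<in> S // ret_rel S \<tau>" "B \<in> S // ret_rel S \<tau>" for A B
    using that by (rule ret_relI) (rule ret_op_tau_const[OF that])
  ultimately show ?thesis
    using card_Ret_eq_1_iff by metis
qed

lemma permutation_solution_iff: "permutation_solution S \<sigma> \<tau> \<longleftrightarrow> (\<forall>m. c (m mod M) = \<one>)"
proof -
  have "(\<forall>x \<in> S. \<forall>y \<in> S. (x, y) \<in> ret_rel S \<tau>) \<longleftrightarrow> (\<forall>m. c (m mod M) = \<one>)"
  proof safe
    fix m
    assume "\<forall>x \<in> S. \<forall>y \<in> S. (x, y) \<in> ret_rel S \<tau>"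
    then have "((\<one>, m mod M), (\<one>, 0)) \<in> ret_rel S \<tau>" by simp
    \<comment> \<open>Evaluation at index 1 yields \<open>q (m + 1) 0\<close> and
      \<open>q 1 0\<close>, which differ only in \<open>c (m mod M)\<close> against
      \<open>c 0\<close>.\<close>
    moreover have "(\<one>, 1 mod M) \<in> S" by simp
    ultimately have "\<tau> (\<one>, m mod M) (\<one>, 1 mod M) = \<tau> (\<one>, 0) (\<one>, 1 mod M)"
      unfolding ret_rel_def by blast
    then have "inv q (m + 1) 0 = inv q 1 0"
      by simp
    then have "q (m + 1) 0 = q 1 0"
      by (metis inv_inv q_closed)
    then show "c (m mod M) = \<one>"
      by (simp add: q_def c_0)
  next
    assume "\<forall>m. c (m mod M) = \<one>"
    then have q: "q i j = \<one>" for i j by (simp add: q_def)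
    show "((a, i), (b, j)) \<in> ret_rel S \<tau>"
      if "a \<in> carrier G" "i \<in> Zset n" "b \<in> carrier G" "j \<in> Zset n" for a i b j
      by (rule ret_relI) (use that q in auto)
  qed
  then show ?thesis
    unfolding permutation_solution_def using ybe_solution card_Ret_eq_1_iff[OF S_nonempty] by simp
qed

section \<open>The permutation and displacement groups\<close>

text \<open>Indexed by all integers to fit the abstract exchange relation. The subscript's first
  coordinate is set to \<open>\<one>\<close>, since \<open>\<sigma>\<close> ignores it.\<close>

definition p :: "int \<Rightarrow> 'a \<times> int \<Rightarrow> 'a \<times> int" where
  "p i = restrict (\<sigma> (\<one>, i mod M)) S"

lemma restrict_sigma: "i \<in> Zset n \<Longrightarrow> restrict (\<sigma> (a, i)) S = p i"
  by (auto simp: p_def restrict_def fun_eq_iff mem_Zset_iff)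

lemma p_apply [simp]: "b \<in> carrier G \<Longrightarrow> j \<in> Zset n \<Longrightarrow> p i (b, j) = (b \<otimes> q i j, (j + 1) mod M)"
  by (simp add: p_def)

lemma p_mod [simp]: "p (i mod M) = p i"
  by (simp add: p_def)

lemma p_Bij [simp]: "p i \<in> Bij S"
  unfolding Bij_def p_def using sigma_bij[of "(\<one>, i mod M)"] by simp

lemma inv_p_apply [simp]:
  assumes "b \<in> carrier G" "j \<in> Zset n"
  shows "(inv\<^bsub>BijGroup S\<^esub> p i) (b, j) = (b \<otimes> inv q i (j - 1), (j - 1) mod M)"
proof -
  let ?x = "(b \<otimes> inv q i (j - 1), (j - 1) mod M)"
  have "p i ?x = (b, j)"
    using assms by (simp add: m_assoc mod_simps mem_Zset_iff)
  moreover have "?x \<in> S" using assms by simp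
  ultimately show ?thesis
    using BijGroup_inv_apply(2)[of "p i" S ?x] by simp
qed

text \<open>At a point with index \<open>k\<close> this is \<open>q_exchange\<close>.\<close>

lemma p_mult: "p i \<otimes>\<^bsub>BijGroup S\<^esub> p j = p (j + 1) \<otimes>\<^bsub>BijGroup S\<^esub> p (i - 1)"
proof -
  have "p i (p j x) = p (j + 1) (p (i - 1) x)" if "x \<in> S" for x
    using that q_exchange by (cases x) (simp add: m_assoc)
  then show ?thesis
    by (auto simp: BijGroup_def compose_def restrict_def fun_eq_iff)
qed

lemma sigma_perms: "{restrict (\<sigma> x) S | x. x \<in> S} = range p"
proof -
  have "p i \<in> {restrict (\<sigma> x) S | x. x \<in> S}" for i
    using restrict_sigma[of "i mod M" \<one>] by (auto intro!: exI[of _ "\<one>"] exI[of _ "i mod M"])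
  then show ?thesis by (auto simp: restrict_sigma)
qed

lemma perm_group_eq: "perm_group S \<sigma> = (BijGroup S)\<lparr>carrier := generate (BijGroup S) (range p)\<rparr>"
  unfolding perm_group_def sigma_perms ..

lemma dis_group_eq:
  "dis_group S \<sigma> = generate (BijGroup S) {p i \<otimes>\<^bsub>BijGroup S\<^esub> inv\<^bsub>BijGroup S\<^esub> p j | i j. True}"
proof -
  have "{restrict (\<sigma> x) S \<otimes>\<^bsub>BijGroup S\<^esub> inv\<^bsub>BijGroup S\<^esub> restrict (\<sigma> y) S | x y. x \<in> S \<and> y \<in> S}
      = {f \<otimes>\<^bsub>BijGroup S\<^esub> inv\<^bsub>BijGroup S\<^esub> g | f g.
          f \<in> {restrict (\<sigma> x) S | x. x \<in> S} \<and> g \<in> {restrict (\<sigma> x) S | x. x \<in> S}}"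
    by blast
  then show ?thesis
    unfolding dis_group_def sigma_perms by (intro arg_cong[of _ _ "generate _"]) blast
qed

text \<open>On each generator, \<open>inv p j\<close> lowers the index by one and \<open>p i\<close>
  raises it again.\<close>

lemma dis_group_snd:
  assumes "h \<in> dis_group S \<sigma>"
  shows "h \<in> Bij S" "\<forall>x \<in> S. snd (h x) = snd x"
proof -
  interpret B: group "BijGroup S" by (rule group_BijGroup)
  have "p i \<otimes>\<^bsub>BijGroup S\<^esub> inv\<^bsub>BijGroup S\<^esub> p j \<in> Bij S" for i j
    using B.m_closed[of "p i" "inv\<^bsub>BijGroup S\<^esub> p j"] by (simp add: carrier_BijGroup BijGroup_inv_closed)
  then have "dis_group S \<sigma> \<subseteq> {h \<in> Bij S. \<forall>x \<in> S. snd (h x) = snd x}"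
    unfolding dis_group_eq
    by (intro B.generate_subgroup_incl subgroup_BijGroup_invariant)
      (auto simp: BijGroup_mult_apply BijGroup_inv_closed mod_simps mem_Zset_iff)
  then show "h \<in> Bij S" "\<forall>x \<in> S. snd (h x) = snd x"
    using assms by blast+
qed

text \<open>For $k \ge 0$ the function is $P(j) = -\sum_{l<k} c_{l-j}$, which is visibly periodic in $j$.\<close>

lemma potential_exists:
  "\<exists>P. (\<forall>j. P j \<in> carrier G \<and> P (j mod M) = P j \<and> P (j + 1) = P j \<otimes> q k j)"
proof (induction k rule: int_induct[where k = 0])
  case base
  show ?case by (rule exI[of _ "\<lambda>_. \<one>"]) (simp add: q_def)
next
  case (step1 k)
  then obtain P where P: "\<And>j. P j \<in> carrier G" "\<And>j. P (j mod M) = P j"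
    "\<And>j. P (j + 1) = P j \<otimes> q k j" by blast
  have "P (j + 1) \<otimes> inv c ((k - (j + 1)) mod M) = P j \<otimes> inv c ((k - j) mod M) \<otimes> q (k + 1) j" for j
  proof -
    have "k + 1 - j - 1 = k - j" "k - (j + 1) = k - j - 1" by simp_all
    \<comment> \<open>Here \<open>x\<close> is \<open>P j\<close>, \<open>z\<close> is the inverse
      of \<open>c\<close> at \<open>- j - 1\<close>, and \<open>y\<close>, \<open>w\<close> are
      \<open>c\<close> at \<open>k - j - 1\<close> and \<open>k - j\<close>.\<close>
    moreover have "x \<otimes> (y \<otimes> z) \<otimes> inv y = x \<otimes> inv w \<otimes> (w \<otimes> z)"
      if "w \<in> carrier G" "x \<in> carrier G" "y \<in> carrier G" "z \<in> carrier G" for w x y z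
      using that by (simp add: m_assoc m_comm[of y]) (simp add: m_assoc[symmetric])
    ultimately show ?thesis by (simp only: P q_def c_mod_closed inv_closed)
  qed
  then show ?case
    using P by (intro exI[of _ "\<lambda>j. P j \<otimes> inv c ((k - j) mod M)"]) (simp add: mod_simps)
next
  case (step2 k)
  then obtain P where P: "\<And>j. P j \<in> carrier G" "\<And>j. P (j mod M) = P j"
    "\<And>j. P (j + 1) = P j \<otimes> q k j" by blast
  \<comment> \<open>Below 0 the summands enter with the opposite sign: \<open>P j\<close> becomes
    the product of the values of \<open>c\<close> at \<open>l - j\<close> for
    \<open>k - 1 \<le> l < 0\<close>.\<close>
  have "P (j + 1) \<otimes> c ((k - 1 - (j + 1)) mod M) = P j \<otimes> c ((k - 1 - j) mod M) \<otimes> q (k - 1) j" for j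
  proof -
    have "k - 1 - j = k - j - 1" "k - 1 - (j + 1) = k - j - 1 - 1" by simp_all
    then show ?thesis by (simp only: P q_def m_ac c_mod_closed inv_closed m_closed)
  qed
  then show ?case
    using P by (intro exI[of _ "\<lambda>j. P j \<otimes> c ((k - 1 - j) mod M)"]) (simp add: mod_simps)
qed

lemma dis_group_Int_cyclic:
  "dis_group S \<sigma> \<inter> generate (BijGroup S) {p k} \<subseteq> {\<one>\<^bsub>BijGroup S\<^esub>}"
proof
  interpret B: group "BijGroup S" by (rule group_BijGroup)
  fix h assume h: "h \<in> dis_group S \<sigma> \<inter> generate (BijGroup S) {p k}"
  obtain P where P: "\<And>j. P j \<in> carrier G" "\<And>j. P (j mod M) = P j"
    "\<And>j. P (j + 1) = P j \<otimes> q k j" using potential_exists by blast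
  \<comment> \<open>Under \<open>p k\<close> both \<open>fst x\<close> and \<open>P (snd x)\<close>
    gain the factor \<open>q k (snd x)\<close>, so the quotient is invariant.\<close>
  define I where "I x = fst x \<otimes> inv P (snd x)" for x :: "'a \<times> int"
  have "I (p k x) = I x" if "x \<in> S" for x
    using that by (cases x) (simp add: I_def P inv_mult m_assoc m_lcomm[of "q k _"])
  then have "generate (BijGroup S) {p k} \<subseteq> {h \<in> Bij S. \<forall>x \<in> S. I (h x) = I x}"
    by (intro B.generate_subgroup_incl subgroup_BijGroup_invariant) (use p_Bij in blast)
  then have inv: "I (h x) = I x" if "x \<in> S" for x
    using h that by blast
  have "h x = x" if "x \<in> S" for x
  proof -
    have "h \<in> dis_group S \<sigma>" using h by simp
    then have snd: "snd (h x) = snd x" and hx: "h x \<in> S"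
      using dis_group_snd(2) that Bij_apply_mem[OF dis_group_snd(1) that] by blast+
    \<comment> \<open>With equal second coordinates the values of \<open>P\<close> in the invariant
      cancel.\<close>
    then have "fst (h x) = fst x"
      using inv[OF that] that hx P(1) by (simp add: I_def mem_Times_iff)
    then show ?thesis using snd by (simp add: prod_eq_iff)
  qed
  moreover have "h \<in> extensional S"
    using h dis_group_snd(1) Bij_imp_extensional by blast
  ultimately show "h \<in> {\<one>\<^bsub>BijGroup S\<^esub>}"
    by (auto simp: BijGroup_def fun_eq_iff extensional_def)
qed

lemma semidirect_product:
  assumes "k \<in> Zset n"
  shows "internal_semidirect_product (perm_group S \<sigma>) (dis_group S \<sigma>)
    (generate (BijGroup S) {restrict (\<sigma> (e, k)) S})"
  unfolding perm_group_eq dis_group_eq restrict_sigma[OF assms]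
proof (rule group.semidirect_product_generate[OF group_BijGroup])
  show "p i \<in> carrier (BijGroup S)" for i
    by (simp add: carrier_BijGroup)
qed (fact p_mult dis_group_Int_cyclic[unfolded dis_group_eq])+

section \<open>Transitivity\<close>

text \<open>The orbit relation of the permutation group, with membership built in so that symmetry
  and transitivity carry no side conditions.\<close>

definition reach :: "'a \<times> int \<Rightarrow> 'a \<times> int \<Rightarrow> bool" where
  "reach x y \<longleftrightarrow> x \<in> S \<and> (\<exists>h \<in> generate (BijGroup S) (range p). h x = y)"

lemma range_p: "range p \<subseteq> carrier (BijGroup S)"
  unfolding carrier_BijGroup using p_Bij by blast

lemma generate_p_Bij: "h \<in> generate (BijGroup S) (range p) \<Longrightarrow> h \<in> Bij S"
  using group.generate_in_carrier[OF group_BijGroup range_p] unfolding carrier_BijGroup .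

lemma reach_trans:
  assumes "reach x y" "reach y z"
  shows "reach x z"
proof -
  obtain g h where "g \<in> generate (BijGroup S) (range p)" "h \<in> generate (BijGroup S) (range p)"
    "g x = y" "h y = z" "x \<in> S"
    using assms unfolding reach_def by blast
  then show ?thesis unfolding reach_def
    using generate.eng[of h "BijGroup S" "range p" g] generate_p_Bij BijGroup_mult_apply[of h S g x]
    by metis
qed

lemma reach_sym:
  assumes "reach x y"
  shows "reach y x"
proof -
  obtain g where g: "g \<in> generate (BijGroup S) (range p)" "g x = y" "x \<in> S"
    using assms unfolding reach_def by blast
  have "inv\<^bsub>BijGroup S\<^esub> g \<in> generate (BijGroup S) (range p)"
    by (rule group.generate_m_inv_closed[OF group_BijGroup range_p g(1)])
  then show ?thesis
    using g generate_p_Bij BijGroup_inv_apply(2)[of g S x] Bij_apply_mem[of g S x]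
    unfolding reach_def by metis
qed

lemma reach_p: "x \<in> S \<Longrightarrow> reach x (p i x)"
  unfolding reach_def by (auto intro: generate.incl)

lemma reach_mult_c:
  assumes "b \<in> carrier G" "k \<in> Zset n"
  shows "reach (b, k) (b \<otimes> c (m mod M), k)"
proof -
  \<comment> \<open>The preimage of \<open>(b, k)\<close> under \<open>p k\<close>. Going forward
    with \<open>p (k + m)\<close> instead changes the result by \<open>c (m mod M)\<close> against
    \<open>c 0 = \<one>\<close>.\<close>
  let ?x = "(b \<otimes> inv q k (k - 1), (k - 1) mod M)"
  have "?x \<in> S" using assms by simp
  moreover have "p k ?x = (b, k)" "p (k + m) ?x = (b \<otimes> c (m mod M), k)"
    using assms by (simp_all add: m_assoc mod_simps mem_Zset_iff) (simp add: q_def m_ac inv_mult c_0)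
  ultimately show ?thesis
    using reach_p[of ?x k] reach_p[of ?x "k + m"] by (metis reach_sym reach_trans)
qed

lemma reach_mult:
  assumes "g \<in> generate G (c ` Zset n)" "b \<in> carrier G" "k \<in> Zset n"
  shows "reach (b, k) (b \<otimes> g, k)"
  using assms
\<comment> \<open>The base point varies because the second factor of a product starts at
  \<open>b \<otimes> g\<close>.\<close>
proof (induction arbitrary: b)
  case one
  then show ?case using reach_mult_c[of b k 0] by (simp add: c_0)
next
  case (incl h)
  then obtain m where "h = c (m mod M)" by (metis imageE mem_Zset_iff)
  then show ?case using incl reach_mult_c by simp
next
  case (inv h)
  then obtain m where "h = c (m mod M)" by (metis imageE mem_Zset_iff)
  \<comment> \<open>Multiplication by \<open>h\<close> leads from \<open>b \<otimes> inv h\<close>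
    to \<open>b\<close>, and the path is reversed.\<close>
  then show ?case
    using inv reach_mult_c[of "b \<otimes> inv h" k m] by (auto simp: m_assoc intro: reach_sym)
next
  case (eng g h)
  have "g \<in> carrier G" "h \<in> carrier G"
    using eng.hyps generate_in_carrier[of "c ` Zset n"] c_closed by blast+
  then show ?case
    using eng.IH(1)[of b] eng.IH(2)[of "b \<otimes> g"] eng.prems reach_trans by (simp add: m_assoc)
qed

lemma indecomposable:
  assumes gen: "generate G (c ` Zset n) = carrier G"
  shows "indecomposable S \<sigma>"
proof -
  interpret B: group "BijGroup S" by (rule group_BijGroup)
  let ?K = "generate (BijGroup S) (range p)"
  have subK: "subgroup ?K (BijGroup S)"
    by (rule B.generate_is_subgroup[OF range_p])
  have same_index: "reach (a, k) (b, k)" if "a \<in> carrier G" "b \<in> carrier G" "k \<in> Zset n" for a b k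
    using reach_mult[of "inv a \<otimes> b" a k] that gen by (simp add: m_assoc[symmetric])
  \<comment> \<open>\<open>p 0\<close> passes to the next fibre and \<open>same_index\<close>
    restores the first coordinate. Downward steps use the same path reversed.\<close>
  have change_index: "reach (a, 0 mod M) (a, t mod M)" if a: "a \<in> carrier G" for a t
  proof (induction t rule: int_induct[where k = 0])
    case base
    then show ?case using a by (intro same_index) auto
  next
    case (step1 t)
    have "reach (a, t mod M) (a \<otimes> q 0 t, (t + 1) mod M)"
      using reach_p[of "(a, t mod M)" 0] a by (simp add: mod_simps)
    moreover have "reach (a \<otimes> q 0 t, (t + 1) mod M) (a, (t + 1) mod M)"
      using a by (intro same_index) auto
    ultimately show ?case using step1 reach_trans by blast
  next
    case (step2 t)
    have "reach (a, (t - 1) mod M) (a \<otimes> q 0 (t - 1), t mod M)"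
      using reach_p[of "(a, (t - 1) mod M)" 0] a by (simp add: mod_simps)
    moreover have "reach (a \<otimes> q 0 (t - 1), t mod M) (a, t mod M)"
      using a by (intro same_index) auto
    ultimately show ?case using step2 reach_trans reach_sym by blast
  qed
  have "reach x y" if "x \<in> S" "y \<in> S" for x y
  proof -
    obtain a i b j where xy: "x = (a, i)" "y = (b, j)" by fastforce
    then have "reach (a, i) (b, i)" "reach (b, i) (b, 0)" "reach (b, 0) (b, j)"
      using that same_index change_index[of b i] change_index[of b j] reach_sym by (auto simp: mem_Zset_iff)
    then show ?thesis unfolding xy using reach_trans by blast
  qed
  then have "\<exists>h \<in> ?K. h x = y" if "x \<in> S" "y \<in> S" for x y
    using that unfolding reach_def by blast
  moreover have "group_hom ((BijGroup S)\<lparr>carrier := ?K\<rparr>) (BijGroup S) (\<lambda>g. g)"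
    using subgroup.subset[OF subK] B.subgroup_imp_group[OF subK] B.is_group
    by (auto simp: group_hom_def group_hom_axioms_def hom_def)
  ultimately show ?thesis
    unfolding indecomposable_def perm_group_eq
    by (simp add: transitive_action_def transitive_action_axioms_def group_action_def)
qed

text \<open>A permutation solution has all \<open>c m\<close> trivial, and these generate the group.
  This isolates the degenerate case of level 1.\<close>

lemma permutation_solution_iff_trivial:
  assumes gen: "generate G (c ` Zset n) = carrier G"
  shows "permutation_solution S \<sigma> \<tau> \<longleftrightarrow> carrier G = {\<one>}"
proof
  assume "permutation_solution S \<sigma> \<tau>"
  then have "c m = \<one>" if "m \<in> Zset n" for m
    using that unfolding permutation_solution_iff by (metis mem_Zset_iff)
  then have "c ` Zset n \<subseteq> {\<one>}" by blast
  then have "carrier G \<subseteq> {\<one>}"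
    using mono_generate gen generate_one by blast
  then show "carrier G = {\<one>}" by blast
next
  assume "carrier G = {\<one>}"
  then show "permutation_solution S \<sigma> \<tau>"
    unfolding permutation_solution_iff using c_mod_closed by blast
qed

end

theorem theorem4p1:
  fixes G :: "('a, 'b) monoid_scheme" and n :: enat and c :: "int \<Rightarrow> 'a"
  assumes "n \<noteq> 0"
    and "comm_group G"
    and "c \<in> Zset n \<rightarrow> carrier G"
    and "c 0 = \<one>\<^bsub>G\<^esub>"
    and "generate G (c ` Zset n) = carrier G"
  defines "S \<equiv> carrier G \<times> Zset n"
    and "\<sigma> \<equiv> sol_sigma G n c"
    and "\<tau> \<equiv> sol_tau G n c"
  shows "ybe_solution S \<sigma> \<tau> \<and> indecomposable S \<sigma> \<and>
    (carrier G \<noteq> {\<one>\<^bsub>G\<^esub>} \<longrightarrow> multipermutation_level_2 S \<sigma> \<tau>) \<and>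
    (carrier G = {\<one>\<^bsub>G\<^esub>} \<longrightarrow> permutation_solution S \<sigma> \<tau>) \<and>
    (\<forall>e \<in> carrier G. \<forall>k \<in> Zset n.
       internal_semidirect_product (perm_group S \<sigma>) (dis_group S \<sigma>)
         (generate (BijGroup S) {restrict (\<sigma> (e, k)) S}))"
proof -
  interpret comm_group G by fact
  interpret cyclic_family G n c by unfold_locales fact+
  show ?thesis
    unfolding S_def \<sigma>_def \<tau>_def multipermutation_level_2_def
      permutation_solution_iff_trivial[OF assms(5)]
    using ybe_solution indecomposable[OF assms(5)] card_Ret_Ret semidirect_product by simp
qed

end
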